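(* Let $\alpha\in\mathbb{R}$ be either rational, or irrational with Liouville–Roth constant $\mu_0(\alpha)>2$. Then for every $\beta>0$ the set $F_2(\alpha,\beta)$ has Property A, i.e. every trigonometric polynomial $t\ge0$ on $\mathbb{T}^2$ with $\mathrm{freq}(t)\subseteq F_2(\alpha,\beta)-F_2(\alpha,\beta)$ is a uniform limit on $\mathbb{T}^2$ of functions $|p|^2$ with $p$ trigonometric polynomials satisfying $\mathrm{freq}(p)\subseteq F_2(\alpha,\beta)$.
   Context: $\mathbb{T}=\mathbb{R}/\mathbb{Z}$. $\mathfrak{T}_2$: trigonometric polynomials on $\mathbb{T}^2$; $\mathfrak{T}_2^+=\{t\in\mathfrak{T}_2:t\ge0\}$; for $F\subseteq\mathbb{Z}^2$, $\mathfrak{T}_2(F)=\{t:\mathrm{freq}(t)\subseteq F\}$, $\mathfrak{T}_2^+(F)=\mathfrak{T}_2^+\cap\mathfrak{T}_2(F)$, $\mathfrak{S}_2(F)=\{|p|^2:p\in\mathfrak{T}_2(F)\}$, $\mathfrak{U}_2(F)=\mathfrak{T}_2\cap\overline{\mathfrak{S}_2(F)}$ (sup-norm closure). $F$ has Property A if $\mathfrak{U}_2(F)=\mathfrak{T}_2^+(F-F)$. $F_2(\alpha,\beta)=\{(j,k)\in\mathbb{Z}^2:|k-j\alpha|<\beta\}$. For irrational $\alpha$, the Liouville–Roth constant (irrationality measure) $\mu_0(\alpha)$ is the supremum of all $\mu>0$ for which there are infinitely many pairs $(c,d)$ of coprime integers with $|\alpha+c/d|<|d|^{-\mu}$. *)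

theory Defs
  imports "HOL-Analysis.Analysis"
begin

text \<open>Functions on the torus T^2 are represented as functions on real x real
 (periodic ones). A trigonometric polynomial with coefficient function c
 (finitely supported on int x int) is evaluated as below.\<close>

definition trig_eval :: "(int \<times> int \<Rightarrow> complex) \<Rightarrow> real \<times> real \<Rightarrow> complex" where
  "trig_eval c = (\<lambda>(x, y). \<Sum>n\<in>{n. c n \<noteq> 0}.
      c n * cis (2 * pi * (of_int (fst n) * x + of_int (snd n) * y)))"

definition trigpolys_on :: "(int \<times> int) set \<Rightarrow> (real \<times> real \<Rightarrow> complex) set" where
  "trigpolys_on F = {trig_eval c | c. finite {n. c n \<noteq> 0} \<and> {n. c n \<noteq> 0} \<subseteq> F}"

definition trigpolys :: "(real \<times> real \<Rightarrow> complex) set" where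
  "trigpolys = trigpolys_on UNIV"

definition nonneg_trigpolys_on :: "(int \<times> int) set \<Rightarrow> (real \<times> real \<Rightarrow> complex) set" where
  "nonneg_trigpolys_on F = {t \<in> trigpolys_on F. \<forall>z. t z \<in> \<real> \<and> Re (t z) \<ge> 0}"

definition sos_on :: "(int \<times> int) set \<Rightarrow> (real \<times> real \<Rightarrow> complex) set" where
  "sos_on F = {(\<lambda>z. complex_of_real ((cmod (p z))\<^sup>2)) | p. p \<in> trigpolys_on F}"

definition U2 :: "(int \<times> int) set \<Rightarrow> (real \<times> real \<Rightarrow> complex) set" where
  "U2 F = {t \<in> trigpolys. \<forall>\<epsilon>>0. \<exists>s\<in>sos_on F. \<forall>z. cmod (t z - s z) \<le> \<epsilon>}"

definition diffset :: "(int \<times> int) set \<Rightarrow> (int \<times> int) set" where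
  "diffset F = {(fst a - fst b, snd a - snd b) | a b. a \<in> F \<and> b \<in> F}"

definition property_A :: "(int \<times> int) set \<Rightarrow> bool" where
  "property_A F \<longleftrightarrow> U2 F = nonneg_trigpolys_on (diffset F)"

definition F2 :: "real \<Rightarrow> real \<Rightarrow> (int \<times> int) set" where
  "F2 \<alpha> \<beta> = {(j, k). \<bar>of_int k - of_int j * \<alpha>\<bar> < \<beta>}"

definition liouville_roth :: "real \<Rightarrow> ereal" where
  "liouville_roth \<alpha> = (SUP \<mu> \<in> {\<mu>::real. \<mu> > 0 \<and>
      infinite {(c :: int, d :: int). coprime c d \<and>
        \<bar>\<alpha> + of_int c / of_int d\<bar> < \<bar>of_int d\<bar> powr (- \<mu>)}}. ereal \<mu>)"

end

theory Submission
  imports Defs "HOL-Library.Real_Mod" "HOL-Real_Asymp.Real_Asymp"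
begin

text \<open>Order frequencies by \<open>lam (j, k) = k - j * \<alpha>\<close>. If \<open>t > 0\<close> has frequencies with
  \<open>lam \<le> L\<close>, let \<open>g\<close> be the part of \<open>ln t\<close> with frequencies \<open>lam > 0\<close> together with half of the
  part with \<open>lam = 0\<close>. Then \<open>p = exp g\<close> has frequencies with \<open>lam \<ge> 0\<close> and satisfies
  \<open>\<bar>p\<bar>\<^sup>2 = t\<close>; since also \<open>p = t * exp (- cnj g)\<close>, its frequencies satisfy \<open>lam \<le> L\<close>. If
  \<open>L = lam a - lam b\<close> with \<open>a\<close>, \<open>b\<close> in \<open>F2 \<alpha> \<beta>\<close>, a shift by \<open>a\<close> moves them into \<open>F2 \<alpha> \<beta>\<close>.

  To stay within trigonometric polynomials, scale \<open>t\<close> to \<open>1 - u\<close> with \<open>\<bar>u\<bar> \<le> \<rho> < 1\<close> and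
  truncate the series of \<open>ln (1 - u)\<close> and of \<open>exp\<close>. The sup-norm errors are exponentially small, whereas the
  number of frequencies grows polynomially, so cutting off the frequencies with \<open>lam > L\<close> is harmless.\<close>

section \<open>Trigonometric polynomials\<close>

definition chr :: "int \<times> int \<Rightarrow> real \<times> real \<Rightarrow> complex" where
  "chr n z = cis (2 * pi * (of_int (fst n) * fst z + of_int (snd n) * snd z))"

lemma chr_add: "chr (m + n) z = chr m z * chr n z"
  by (simp add: chr_def cis_mult algebra_simps)

lemma chr_0 [simp]: "chr 0 z = 1"
  by (simp add: chr_def)

lemma cnj_chr: "cnj (chr n z) = chr (- n) z"
  by (simp add: chr_def cis_cnj algebra_simps)

lemma norm_chr [simp]: "cmod (chr n z) = 1"
  by (simp add: chr_def)

text \<open>The support may be padded to any finite superset, so that two polynomials can be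
  compared over a common index set.\<close>

lemma trig_eval_eq:
  assumes "finite A" "{n. c n \<noteq> 0} \<subseteq> A"
  shows "trig_eval c z = (\<Sum>n\<in>A. c n * chr n z)"
proof -
  have "trig_eval c z = (\<Sum>n\<in>{n. c n \<noteq> 0}. c n * chr n z)"
    by (simp add: trig_eval_def chr_def split: prod.split)
  also have "\<dots> = (\<Sum>n\<in>A. c n * chr n z)"
    using assms by (intro sum.mono_neutral_left) auto
  finally show ?thesis .
qed

lemma trigpolys_onI:
  assumes "finite A" "A \<subseteq> S" "\<And>z. f z = (\<Sum>n\<in>A. c n * chr n z)"
  shows "f \<in> trigpolys_on S"
proof -
  \<comment> \<open>Nothing is assumed about \<open>c\<close> off \<open>A\<close>, so it is set to
    zero there.\<close>
  define d where "d = (\<lambda>n. if n \<in> A then c n else 0)"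
  have dA: "{n. d n \<noteq> 0} \<subseteq> A"
    by (auto simp: d_def)
  have "f z = trig_eval d z" for z
    unfolding trig_eval_eq[OF assms(1) dA] assms(3) by (intro sum.cong) (auto simp: d_def)
  then have "f = trig_eval d" by blast
  moreover have "finite {n. d n \<noteq> 0}" "{n. d n \<noteq> 0} \<subseteq> S"
    using dA assms finite_subset by blast+
  ultimately show ?thesis
    unfolding trigpolys_on_def by blast
qed

lemma trigpolys_onE:
  assumes "f \<in> trigpolys_on S"
  obtains c A where "finite A" "A \<subseteq> S" "{n. c n \<noteq> 0} \<subseteq> A"
    "\<And>z. f z = (\<Sum>n\<in>A. c n * chr n z)"
proof -
  obtain c where c: "f = trig_eval c" "finite {n. c n \<noteq> 0}" "{n. c n \<noteq> 0} \<subseteq> S"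
    using assms by (auto simp: trigpolys_on_def)
  show ?thesis
    by (rule that[OF c(2,3) order.refl]) (use c trig_eval_eq[OF c(2) order.refl] in auto)
qed

lemma trigpolys_on_mono: "f \<in> trigpolys_on S \<Longrightarrow> S \<subseteq> T \<Longrightarrow> f \<in> trigpolys_on T"
  by (auto simp: trigpolys_on_def)

lemma trigpolys_on_monom: "n \<in> S \<Longrightarrow> (\<lambda>z. k * chr n z) \<in> trigpolys_on S"
  by (rule trigpolys_onI[of "{n}" _ _ "\<lambda>_. k"]) auto

lemma trigpolys_on_const: "0 \<in> S \<Longrightarrow> (\<lambda>z. k) \<in> trigpolys_on S"
  using trigpolys_on_monom[of 0 S k] by simp

lemma trigpolys_on_add:
  assumes "f \<in> trigpolys_on S" "g \<in> trigpolys_on S"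
  shows "(\<lambda>z. f z + g z) \<in> trigpolys_on S"
proof -
  obtain c A where c: "finite A" "A \<subseteq> S" "{n. c n \<noteq> 0} \<subseteq> A" "\<And>z. f z = (\<Sum>n\<in>A. c n * chr n z)"
    using assms(1) by (rule trigpolys_onE) blast
  obtain d B where d: "finite B" "B \<subseteq> S" "{n. d n \<noteq> 0} \<subseteq> B" "\<And>z. g z = (\<Sum>n\<in>B. d n * chr n z)"
    using assms(2) by (rule trigpolys_onE) blast
  have "f z = (\<Sum>n\<in>A \<union> B. c n * chr n z)" "g z = (\<Sum>n\<in>A \<union> B. d n * chr n z)" for z
    unfolding c d using c d by (intro sum.mono_neutral_left; auto)+
  then have "f z + g z = (\<Sum>n\<in>A \<union> B. (c n + d n) * chr n z)" for z
    by (simp add: sum.distrib algebra_simps)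
  with c d show ?thesis
    by (intro trigpolys_onI[of "A \<union> B"]) auto
qed

lemma trigpolys_on_sum:
  assumes "\<And>i. i \<in> I \<Longrightarrow> f i \<in> trigpolys_on S"
  shows "(\<lambda>z. \<Sum>i\<in>I. f i z) \<in> trigpolys_on S"
proof (cases "finite I")
  case True
  then show ?thesis
    using assms
  proof (induction I)
    case empty
    then show ?case by (auto intro: trigpolys_onI[of "{}"])
  next
    case (insert i I)
    then show ?case by (simp add: trigpolys_on_add)
  qed
next
  case False
  then show ?thesis by (auto intro: trigpolys_onI[of "{}"])
qed

lemma trigpolys_on_mult:
  assumes "f \<in> trigpolys_on S" "g \<in> trigpolys_on T"
    and "\<And>a b. a \<in> S \<Longrightarrow> b \<in> T \<Longrightarrow> a + b \<in> U"
  shows "(\<lambda>z. f z * g z) \<in> trigpolys_on U"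
proof -
  obtain c A where c: "finite A" "A \<subseteq> S" "{n. c n \<noteq> 0} \<subseteq> A" "\<And>z. f z = (\<Sum>n\<in>A. c n * chr n z)"
    using assms(1) by (rule trigpolys_onE) blast
  obtain d B where d: "finite B" "B \<subseteq> T" "{n. d n \<noteq> 0} \<subseteq> B" "\<And>z. g z = (\<Sum>n\<in>B. d n * chr n z)"
    using assms(2) by (rule trigpolys_onE) blast
  have "f z * g z = (\<Sum>m\<in>A. \<Sum>n\<in>B. (c m * d n) * chr (m + n) z)" for z
    by (simp add: c d sum_product chr_add mult_ac)
  moreover have "(\<lambda>z. \<Sum>m\<in>A. \<Sum>n\<in>B. (c m * d n) * chr (m + n) z) \<in> trigpolys_on U"
    using c(2) d(2) by (intro trigpolys_on_sum trigpolys_on_monom assms(3)) blast+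
  ultimately show ?thesis by simp
qed

lemma trigpolys_on_cmult:
  assumes "f \<in> trigpolys_on S"
  shows "(\<lambda>z. k * f z) \<in> trigpolys_on S"
  by (rule trigpolys_on_mult[OF trigpolys_on_const[of "{0}"] assms]) auto

lemma trigpolys_on_cnj:
  assumes "f \<in> trigpolys_on S" "\<And>a. a \<in> S \<Longrightarrow> - a \<in> T"
  shows "(\<lambda>z. cnj (f z)) \<in> trigpolys_on T"
proof -
  obtain c A where c: "finite A" "A \<subseteq> S" "{n. c n \<noteq> 0} \<subseteq> A" "\<And>z. f z = (\<Sum>n\<in>A. c n * chr n z)"
    using assms(1) by (rule trigpolys_onE) blast
  have "(\<lambda>z. \<Sum>n\<in>A. cnj (c n) * chr (- n) z) \<in> trigpolys_on T"
    using c assms(2) by (intro trigpolys_on_sum trigpolys_on_monom) auto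
  then show ?thesis by (simp add: c cnj_chr)
qed

text \<open>The family \<open>T\<close> serves both for boxes growing linearly with the exponent and
  for half-planes, which are closed under addition and stay fixed.\<close>

lemma trigpolys_on_power:
  assumes "f \<in> trigpolys_on S" "0 \<in> T 0"
    and "\<And>n a b. a \<in> S \<Longrightarrow> b \<in> T n \<Longrightarrow> a + b \<in> T (Suc n)"
  shows "(\<lambda>z. f z ^ n) \<in> trigpolys_on (T n)"
proof (induction n)
  case 0
  then show ?case using assms(2) by (simp add: trigpolys_on_const)
next
  case (Suc n)
  then show ?case using trigpolys_on_mult[OF assms(1) Suc.IH assms(3)] by simp
qed

section \<open>Coefficient bounds\<close>

text \<open>A geometric sum over an \<open>N\<close>-th root of unity; the bound on \<open>k\<close>
  ensures that this root is 1 only for \<open>k = 0\<close>.\<close>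

lemma sum_roots_of_unity:
  fixes k :: int and N :: nat
  assumes "\<bar>k\<bar> < int N"
  shows "(\<Sum>a<N. cis (2 * pi * (of_int k * (real a / real N)))) = (if k = 0 then of_nat N else 0)"
proof (cases "k = 0")
  case False
  have N: "N > 0" using assms by linarith
  define w where "w = cis (2 * pi * of_int k / real N)"
  have "w \<noteq> 1"
  proof
    assume "w = 1"
    then obtain n :: int where "2 * pi * of_int k / real N = of_int n * (2 * pi)"
      by (auto simp: w_def cis_eq_1_iff)
    then have "real_of_int k = of_int n * real N"
      using N by (simp add: field_simps)
    then have "real_of_int k = real_of_int (n * int N)" by simp
    then have "k = n * int N" by (simp only: of_int_eq_iff)
    with assms have "\<bar>n\<bar> * int N < 1 * int N" by (simp add: abs_mult)
    then have "n = 0" using N by (simp only: mult_less_cancel_right) auto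
    with \<open>k = n * int N\<close> False show False by simp
  qed
  have "w ^ N = cis (2 * pi * of_int k)"
    using N by (simp add: w_def Complex.DeMoivre)
  also have "\<dots> = 1" by (intro cis_multiple_2pi) auto
  finally have "(\<Sum>a<N. w ^ a) = 0"
    using geometric_sum[OF \<open>w \<noteq> 1\<close>, of N] by simp
  moreover have "cis (2 * pi * (of_int k * (real a / real N))) = w ^ a" for a
    by (simp add: w_def Complex.DeMoivre field_simps)
  ultimately show ?thesis using False by simp
qed simp

text \<open>Discrete Fourier inversion: on a sufficiently fine grid the characters involved are
  exactly orthogonal to \<open>chr m\<close>, so \<open>c m\<close> is the average of the polynomial
  times \<open>chr (- m)\<close> over the grid. No integral is required.\<close>

lemma norm_coeff_le:
  assumes A: "finite A" "m \<in> A" and B: "\<And>z. cmod (\<Sum>n\<in>A. c n * chr n z) \<le> B"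
  shows "cmod (c m) \<le> B"
proof -
  \<comment> \<open>The grid size strictly exceeds both coordinates of every \<open>n - m\<close>,
    which excludes aliasing.\<close>
  define N where "N = nat (Max ((\<lambda>n. \<bar>fst n - fst m\<bar> + \<bar>snd n - snd m\<bar>) ` A)) + 1"
  have N: "\<bar>fst n - fst m\<bar> < int N" "\<bar>snd n - snd m\<bar> < int N" if "n \<in> A" for n
  proof -
    have "\<bar>fst n - fst m\<bar> + \<bar>snd n - snd m\<bar> \<le> Max ((\<lambda>n. \<bar>fst n - fst m\<bar> + \<bar>snd n - snd m\<bar>) ` A)"
      using A that by (intro Max_ge) auto
    then show "\<bar>fst n - fst m\<bar> < int N" "\<bar>snd n - snd m\<bar> < int N"
      unfolding N_def by linarith+
  qed
  have N0: "N > 0" by (simp add: N_def)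
  define f where "f z = (\<Sum>n\<in>A. c n * chr n z)" for z
  define z where "z a b = (real a / real N, real b / real N)" for a b
  define s where "s k = (\<Sum>a<N. cis (2 * pi * (of_int k * (real a / real N))))" for k :: int
  have chr_z: "chr n (z a b) * chr (- m) (z a b) =
      cis (2 * pi * (of_int (fst n - fst m) * (real a / real N))) *
      cis (2 * pi * (of_int (snd n - snd m) * (real b / real N)))" for n a b
    by (simp add: chr_def z_def cis_mult algebra_simps)
  have "(\<Sum>a<N. \<Sum>b<N. f (z a b) * chr (- m) (z a b)) =
      (\<Sum>a<N. \<Sum>b<N. \<Sum>n\<in>A. c n * (chr n (z a b) * chr (- m) (z a b)))"
    unfolding f_def sum_distrib_right by (intro sum.cong refl) (simp add: mult_ac)
  also have "\<dots> = (\<Sum>a<N. \<Sum>n\<in>A. \<Sum>b<N. c n * (chr n (z a b) * chr (- m) (z a b)))"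
    by (intro sum.cong refl sum.swap)
  also have "\<dots> = (\<Sum>n\<in>A. \<Sum>a<N. \<Sum>b<N. c n * (chr n (z a b) * chr (- m) (z a b)))"
    by (rule sum.swap)
  also have "\<dots> = (\<Sum>n\<in>A. c n * (s (fst n - fst m) * s (snd n - snd m)))"
    unfolding chr_z s_def sum_product by (simp add: sum_distrib_left)
  also have "\<dots> = (\<Sum>n\<in>A. if n = m then c m * (of_nat N * of_nat N) else 0)"
  proof (intro sum.cong refl)
    fix n assume "n \<in> A"
    then show "c n * (s (fst n - fst m) * s (snd n - snd m)) =
        (if n = m then c m * (of_nat N * of_nat N) else 0)"
      unfolding s_def sum_roots_of_unity[OF N(1)[OF \<open>n \<in> A\<close>]]
        sum_roots_of_unity[OF N(2)[OF \<open>n \<in> A\<close>]]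
      by (cases n; cases m) auto
  qed
  also have "\<dots> = c m * (of_nat N * of_nat N)" using A by simp
  finally have "cmod (c m) * (real N * real N) =
      cmod (\<Sum>a<N. \<Sum>b<N. f (z a b) * chr (- m) (z a b))"
    by (simp add: norm_mult)
  also have "\<dots> \<le> (\<Sum>a<N. \<Sum>b<N. B)"
    using B by (intro sum_norm_le) (simp add: f_def norm_mult)
  also have "\<dots> = B * (real N * real N)" by simp
  finally show ?thesis using N0 by simp
qed

text \<open>As \<open>h\<close> has no frequency \<open>m\<close>, \<open>c m\<close> is the
  coefficient of \<open>f - h\<close> at \<open>m\<close>. This is how uniform closeness transfers a
  restriction on frequencies from \<open>h\<close> to \<open>f\<close>.\<close>

lemma norm_coeff_le_diff:
  assumes "finite A" "\<And>z. f z = (\<Sum>n\<in>A. c n * chr n z)" "h \<in> trigpolys_on B"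
    and "\<And>z. cmod (f z - h z) \<le> e" "m \<in> A" "m \<notin> B"
  shows "cmod (c m) \<le> e"
proof -
  obtain d D where d: "finite D" "D \<subseteq> B" "{n. d n \<noteq> 0} \<subseteq> D" "\<And>z. h z = (\<Sum>n\<in>D. d n * chr n z)"
    using assms(3) by (rule trigpolys_onE) blast
  define c' where "c' n = (if n \<in> A then c n else 0)" for n
  have "f z = (\<Sum>n\<in>A \<union> D. c' n * chr n z)" for z
  proof -
    have "f z = (\<Sum>n\<in>A. c' n * chr n z)"
      unfolding assms(2) by (intro sum.cong) (auto simp: c'_def)
    also have "\<dots> = (\<Sum>n\<in>A \<union> D. c' n * chr n z)"
      using assms(1) d(1) by (intro sum.mono_neutral_left) (auto simp: c'_def)
    finally show ?thesis .
  qed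
  moreover have "h z = (\<Sum>n\<in>A \<union> D. d n * chr n z)" for z
    unfolding d(4) using assms(1) d by (intro sum.mono_neutral_left) auto
  ultimately have diff: "f z - h z = (\<Sum>n\<in>A \<union> D. (c' n - d n) * chr n z)" for z
    by (simp add: sum_subtractf algebra_simps)
  have "cmod (c' m - d m) \<le> e"
  proof (rule norm_coeff_le)
    show "finite (A \<union> D)" "m \<in> A \<union> D" using assms(1,5) d(1) by auto
    show "cmod (\<Sum>n\<in>A \<union> D. (c' n - d n) * chr n z) \<le> e" for z
      using assms(4) unfolding diff .
  qed
  moreover have "d m = 0" using d(2,3) assms(6) by blast
  ultimately show ?thesis using assms(5) by (simp add: c'_def)
qed

section \<open>Frequency boxes and truncation of frequencies\<close>

definition freq_box :: "nat \<Rightarrow> (int \<times> int) set" where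
  "freq_box K = {- int K..int K} \<times> {- int K..int K}"

lemma finite_freq_box [simp]: "finite (freq_box K)"
  by (simp add: freq_box_def)

lemma card_freq_box: "real (card (freq_box K)) = (2 * real K + 1)\<^sup>2"
  by (simp add: freq_box_def card_cartesian_product power2_eq_square)

lemma zero_in_freq_box [simp]: "0 \<in> freq_box K"
  by (simp add: freq_box_def zero_prod_def)

lemma freq_box_add: "a \<in> freq_box K \<Longrightarrow> b \<in> freq_box L \<Longrightarrow> a + b \<in> freq_box (K + L)"
  by (auto simp: freq_box_def)

lemma freq_box_add_Suc: "a \<in> freq_box K \<Longrightarrow> b \<in> freq_box (n * K) \<Longrightarrow> a + b \<in> freq_box (Suc n * K)"
  using freq_box_add[of a K b "n * K"] by simp

lemma freq_box_mono: "K \<le> L \<Longrightarrow> freq_box K \<subseteq> freq_box L"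
  by (auto simp: freq_box_def)

lemma uminus_in_freq_box: "a \<in> freq_box K \<Longrightarrow> - a \<in> freq_box K"
  by (auto simp: freq_box_def)

text \<open>Positivity of \<open>K\<close> is demanded for the asymptotic estimates, which assume a
  positive \<open>D\<close>.\<close>

lemma trigpolys_on_freq_box:
  assumes "f \<in> trigpolys_on S"
  obtains K where "K > 0" "f \<in> trigpolys_on (S \<inter> freq_box K)"
proof -
  obtain c A where c: "finite A" "A \<subseteq> S" "{n. c n \<noteq> 0} \<subseteq> A" "\<And>z. f z = (\<Sum>n\<in>A. c n * chr n z)"
    using assms(1) by (rule trigpolys_onE) blast
  define M where "M = Max (insert 0 ((\<lambda>n. \<bar>fst n\<bar> + \<bar>snd n\<bar>) ` A))"
  have "A \<subseteq> freq_box (nat M + 1)"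
  proof
    fix n assume "n \<in> A"
    then have "\<bar>fst n\<bar> + \<bar>snd n\<bar> \<le> M"
      unfolding M_def using c(1) by (intro Max_ge) auto
    then have "\<bar>fst n\<bar> \<le> int (nat M + 1)" "\<bar>snd n\<bar> \<le> int (nat M + 1)" by linarith+
    then show "n \<in> freq_box (nat M + 1)"
      unfolding freq_box_def mem_Times_iff atLeastAtMost_iff by linarith
  qed
  with c have "f \<in> trigpolys_on (S \<inter> freq_box (nat M + 1))"
    by (intro trigpolys_onI[of A _ _ c]) auto
  then show ?thesis by (intro that[of "nat M + 1"]) auto
qed

text \<open>Each coefficient is at most the sup-norm bound, and the box limits their number: the
  absolute coefficient sum exceeds the sup norm by at most a polynomial factor.\<close>

lemma sum_coeff_le:
  assumes "v \<in> trigpolys_on (S \<inter> freq_box K)" "\<And>z. cmod (v z) \<le> b"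
  obtains c A where "finite A" "A \<subseteq> S \<inter> freq_box K" "\<And>z. v z = (\<Sum>n\<in>A. c n * chr n z)"
    "(\<Sum>n\<in>A. cmod (c n)) \<le> (2 * real K + 1)\<^sup>2 * b"
proof -
  obtain c A where c: "finite A" "A \<subseteq> S \<inter> freq_box K" "{n. c n \<noteq> 0} \<subseteq> A"
      "\<And>z. v z = (\<Sum>n\<in>A. c n * chr n z)"
    using assms(1) by (rule trigpolys_onE) blast
  have b: "0 \<le> b" using assms(2) norm_ge_zero order_trans by blast
  have "(\<Sum>n\<in>A. cmod (c n)) \<le> (\<Sum>n\<in>A. b)"
  proof (rule sum_mono)
    show "cmod (c n) \<le> b" if "n \<in> A" for n
      by (rule norm_coeff_le[OF c(1) that]) (use assms(2) in \<open>simp only: c(4)[symmetric]\<close>)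
  qed
  also have "\<dots> = real (card A) * b" by simp
  also have "\<dots> \<le> real (card (freq_box K)) * b"
    using c(2) b by (intro mult_right_mono of_nat_mono card_mono) auto
  finally show ?thesis
    using that[of A c] c by (simp add: card_freq_box)
qed

text \<open>The trivial bound on the number of frequencies makes truncation of frequencies cost only a
  factor that is polynomial in the size of the box.\<close>

lemma trigpolys_on_truncate:
  assumes "f \<in> trigpolys_on (S \<inter> freq_box K)" "h \<in> trigpolys_on T" "\<And>z. cmod (f z - h z) \<le> e"
  obtains f' where "f' \<in> trigpolys_on (S \<inter> T)" "\<And>z. cmod (f z - f' z) \<le> (2 * real K + 1)\<^sup>2 * e"
proof -
  obtain c A where c: "finite A" "A \<subseteq> S \<inter> freq_box K" "{n. c n \<noteq> 0} \<subseteq> A"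
      "\<And>z. f z = (\<Sum>n\<in>A. c n * chr n z)"
    using assms(1) by (rule trigpolys_onE) blast
  have e: "0 \<le> e" using assms(3) norm_ge_zero order_trans by blast
  define f' where "f' z = (\<Sum>n\<in>A \<inter> T. c n * chr n z)" for z
  have "f' \<in> trigpolys_on (S \<inter> T)"
    using c by (intro trigpolys_onI[of "A \<inter> T" _ _ c]) (auto simp: f'_def)
  moreover have "cmod (f z - f' z) \<le> (2 * real K + 1)\<^sup>2 * e" for z
  proof -
    \<comment> \<open>Only frequencies outside \<open>T\<close> are lost, and there the coefficient
      of \<open>f\<close> is that of \<open>f - h\<close>, hence at most \<open>e\<close>.\<close>
    have "f z - f' z = (\<Sum>n\<in>A - T. c n * chr n z)"
      using c(1) sum.Int_Diff[of A "\<lambda>n. c n * chr n z" T] by (simp add: c(4) f'_def)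
    then have "cmod (f z - f' z) \<le> (\<Sum>n\<in>A - T. e)"
      using norm_coeff_le_diff[OF c(1,4) assms(2,3)]
      by (simp only:) (intro sum_norm_le, auto simp: norm_mult)
    also have "\<dots> = real (card (A - T)) * e" by simp
    also have "\<dots> \<le> real (card (freq_box K)) * e"
      using c(2) e by (intro mult_right_mono of_nat_mono card_mono) auto
    finally show ?thesis by (simp add: card_freq_box)
  qed
  ultimately show ?thesis by (rule that)
qed

section \<open>Scalar estimates\<close>

lemma power_div_fact_le_exp:
  assumes "0 \<le> (x::real)"
  shows "x ^ n / fact n \<le> exp x"
proof -
  have "(\<Sum>k\<in>{n}. x ^ k /\<^sub>R fact k) \<le> (\<Sum>k. x ^ k /\<^sub>R fact k)"
    using assms by (intro sum_le_suminf summable_exp_generic) auto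
  then show ?thesis by (simp add: exp_def divide_inverse mult.commute)
qed

text \<open>Writing \<open>G ^ n / fact n\<close> as
  \<open>(1 / 2) ^ n * ((2 * G) ^ n / fact n)\<close> and bounding the last factor by
  \<open>exp (2 * G)\<close> turns the Taylor remainder into geometric decay.\<close>

lemma exp_truncation_bound:
  assumes "cmod w \<le> G"
  shows "cmod (exp w - (\<Sum>k\<le>n. w ^ k / fact k)) \<le> G * exp (3 * G) * (1 / 2) ^ n"
proof -
  have G: "0 \<le> G" using assms norm_ge_zero order_trans by blast
  have "cmod (exp w - (\<Sum>k\<le>n. w ^ k / fact k)) \<le> exp \<bar>Re w\<bar> * cmod w ^ Suc n / fact n"
    by (rule Taylor_exp)
  also have "\<dots> \<le> exp G * G ^ Suc n / fact n"
    using assms G abs_Re_le_cmod[of w] by (intro divide_right_mono mult_mono power_mono) auto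
  also have "\<dots> = G * exp G * (1 / 2) ^ n * ((2 * G) ^ n / fact n)"
    by (simp add: power_mult_distrib field_simps)
  also have "\<dots> \<le> G * exp G * (1 / 2) ^ n * exp (2 * G)"
    using G by (intro mult_left_mono power_div_fact_le_exp) auto
  also have "\<dots> = G * exp (3 * G) * (1 / 2) ^ n"
    using exp_add[of G "2 * G"] by (simp add: mult_ac)
  finally show ?thesis .
qed

text \<open>The summand for \<open>k = 0\<close> is \<open>1 / 0 = 0\<close>.\<close>

lemma ln_series_tail:
  fixes r \<rho> :: real
  assumes "\<bar>r\<bar> \<le> \<rho>" "\<rho> < 1"
  shows "\<bar>ln (1 - r) + (\<Sum>k<N. r ^ k / real k)\<bar> \<le> \<rho> ^ N / (1 - \<rho>)"
proof -
  have \<rho>: "0 \<le> \<rho>" using assms by linarith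
  define f where "f k = - (r ^ k) / real k" for k
  have "f sums ln (1 - r)"
    using ln_series'[of "- r"] assms by (simp add: f_def[abs_def])
  then have tail: "(\<lambda>k. f (k + N)) sums (ln (1 - r) - (\<Sum>k<N. f k))"
    by (rule sums_split_initial_segment)
  have geo: "(\<lambda>k. \<rho> ^ N * \<rho> ^ k) sums (\<rho> ^ N * (1 / (1 - \<rho>)))"
    using \<rho> assms by (intro sums_mult geometric_sums) auto
  have "\<bar>f (k + N)\<bar> \<le> \<rho> ^ N * \<rho> ^ k" for k
  proof (cases "k + N = 0")
    case False
    then have "\<bar>f (k + N)\<bar> \<le> \<bar>r\<bar> ^ (k + N) / 1"
      unfolding f_def abs_divide abs_minus_cancel power_abs by (intro divide_left_mono) auto
    also have "\<dots> \<le> \<rho> ^ (k + N)" using assms by (simp add: power_mono)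
    finally show ?thesis by (simp add: power_add mult.commute)
  qed (simp add: f_def)
  then have "norm (\<Sum>k. f (k + N)) \<le> (\<Sum>k. \<rho> ^ N * \<rho> ^ k)"
    by (intro norm_suminf_le sums_summable[OF geo]) auto
  then have "\<bar>ln (1 - r) - (\<Sum>k<N. f k)\<bar> \<le> \<rho> ^ N * (1 / (1 - \<rho>))"
    using sums_unique[OF tail] sums_unique[OF geo] by simp
  then show ?thesis by (simp add: f_def sum_negf)
qed

text \<open>Both cases rest on \<open>1 + y \<le> exp y\<close>: at \<open>y = - x\<close>,
  multiplied by \<open>exp x\<close>, for nonnegative \<open>x\<close>, and at \<open>y = x\<close>
  for negative \<open>x\<close>.\<close>

lemma abs_exp_minus_one_le: "\<bar>exp x - 1\<bar> \<le> \<bar>x\<bar> * exp \<bar>x\<bar>" for x :: real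
proof (cases "0 \<le> x")
  case True
  have "exp x * (1 - x) \<le> exp x * exp (- x)"
    using exp_ge_add_one_self[of "- x"] by (intro mult_left_mono) auto
  then show ?thesis using True by (simp add: exp_minus field_simps)
next
  case False
  then have "\<bar>exp x - 1\<bar> \<le> \<bar>x\<bar> * 1"
    using exp_ge_add_one_self[of x] exp_le_one_iff[of x] by linarith
  also have "\<dots> \<le> \<bar>x\<bar> * exp \<bar>x\<bar>" by (intro mult_left_mono) auto
  finally show ?thesis .
qed

lemma abs_norm_square_diff_le:
  assumes "cmod (a - b) \<le> \<kappa>" "cmod b \<le> A"
  shows "\<bar>(cmod a)\<^sup>2 - (cmod b)\<^sup>2\<bar> \<le> \<kappa> * (\<kappa> + 2 * A)"
proof -
  have "\<bar>cmod a - cmod b\<bar> \<le> \<kappa>"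
    using norm_triangle_ineq3[of a b] assms(1) by linarith
  moreover have "(cmod a)\<^sup>2 - (cmod b)\<^sup>2 = (cmod a - cmod b) * (cmod a + cmod b)"
    by (simp add: power2_eq_square algebra_simps)
  ultimately show ?thesis
    using assms(2) by (auto simp: abs_mult intro!: mult_mono)
qed

text \<open>The polynomial factor is the cardinality of \<open>freq_box (N * (N * D))\<close>, the
  box of the truncated exponential of the truncated logarithm.\<close>

lemma tendsto_poly_times_power:
  fixes D \<sigma> :: real
  assumes "D > 0" "0 < \<sigma>" "\<sigma> < 1"
  shows "(\<lambda>N. (2 * (real N * (real N * D)) + 1)\<^sup>2 * \<sigma> ^ N) \<longlonglongrightarrow> 0"
  using assms by real_asymp

text \<open>Here the factor is the cardinality of \<open>freq_box (N * D)\<close>, the box of the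
  \<open>N\<close>-th power of a polynomial with frequencies in \<open>freq_box D\<close>.\<close>

lemma summable_poly_times_power:
  fixes D \<sigma> :: real
  assumes "D > 0" "0 < \<sigma>" "\<sigma> < 1"
  shows "summable (\<lambda>N. (2 * (real N * D) + 1)\<^sup>2 * \<sigma> ^ N)"
proof (rule summable_comparison_test_bigo)
  show "summable (\<lambda>N. norm (inverse (real N ^ 2)))"
    using inverse_power_summable[of 2, where 'a = real] by simp
  show "(\<lambda>N. (2 * (real N * D) + 1)\<^sup>2 * \<sigma> ^ N) \<in> O(\<lambda>N. inverse (real N ^ 2))"
    using assms by real_asymp
qed

section \<open>Approximate spectral factorization\<close>

text \<open>Conjugating a term with \<open>lam n < 0\<close> keeps its real part and reflects its
  frequency. For real-valued \<open>v\<close> the result is the part with \<open>lam > 0\<close>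
  plus half of the part with \<open>lam = 0\<close>. The bound goes through the absolute coefficient
  sum.\<close>

lemma analytic_half:
  fixes lam :: "int \<times> int \<Rightarrow> real"
  assumes "v \<in> trigpolys_on (freq_box K)" "\<And>z. cmod (v z) \<le> b" "\<And>n. lam (- n) = - lam n"
  obtains Q where "Q \<in> trigpolys_on ({n. 0 \<le> lam n} \<inter> freq_box K)"
    "\<And>z. Re (Q z) = Re (v z) / 2" "\<And>z. cmod (Q z) \<le> (2 * real K + 1)\<^sup>2 * b"
proof -
  obtain c A where c: "finite A" "A \<subseteq> freq_box K" "\<And>z. v z = (\<Sum>n\<in>A. c n * chr n z)"
      "(\<Sum>n\<in>A. cmod (c n)) \<le> (2 * real K + 1)\<^sup>2 * b"
    using assms(1,2) by (rule sum_coeff_le[of v UNIV K b, unfolded Int_UNIV_left]) blast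
  define h where "h n z = (if 0 \<le> lam n then c n / 2 * chr n z else cnj (c n / 2) * chr (- n) z)" for n z
  define Q where "Q z = (\<Sum>n\<in>A. h n z)" for z
  have h: "Re (h n z) = Re (c n * chr n z) / 2" "cmod (h n z) = cmod (c n) / 2" for n z
  proof -
    have "cnj (c n / 2) * chr (- n) z = cnj (c n * chr n z / 2)" by (simp add: cnj_chr)
    then show "Re (h n z) = Re (c n * chr n z) / 2"
      unfolding h_def by (simp del: complex_cnj_mult complex_cnj_divide times_complex.sel)
    show "cmod (h n z) = cmod (c n) / 2" by (simp add: h_def norm_mult norm_divide)
  qed
  have "h n \<in> trigpolys_on ({n. 0 \<le> lam n} \<inter> freq_box K)" if "n \<in> A" for n
  proof (cases "0 \<le> lam n")
    case True
    then have "h n = (\<lambda>z. c n / 2 * chr n z)" by (auto simp: h_def)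
    then show ?thesis using True c(2) that by (auto intro!: trigpolys_on_monom simp del: times_divide_eq_left)
  next
    case False
    then have "h n = (\<lambda>z. cnj (c n / 2) * chr (- n) z)" by (auto simp: h_def)
    moreover have "- n \<in> {n. 0 \<le> lam n} \<inter> freq_box K"
      using False c(2) that assms(3)[of n] uminus_in_freq_box[of n K] by auto
    ultimately show ?thesis by (simp only: trigpolys_on_monom)
  qed
  then have "Q \<in> trigpolys_on ({n. 0 \<le> lam n} \<inter> freq_box K)"
    unfolding Q_def by (rule trigpolys_on_sum)
  moreover have "Re (Q z) = Re (v z) / 2" for z
    by (simp only: Q_def c(3) Re_sum h sum_divide_distrib)
  moreover have "cmod (Q z) \<le> (2 * real K + 1)\<^sup>2 * b" for z
  proof -
    have "cmod (Q z) \<le> (\<Sum>n\<in>A. cmod (c n))"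
      unfolding Q_def by (intro sum_norm_le) (simp add: h)
    then show ?thesis using c(4) by linarith
  qed
  ultimately show ?thesis by (rule that)
qed

text \<open>Two polynomials approximate the same exponential \<open>exp (g N z)\<close>:
  \<open>P N\<close> has \<open>lam \<ge> 0\<close> and \<open>R N\<close> has
  \<open>lam \<le> L\<close>. Cutting \<open>P N\<close> down to the half-plane of
  \<open>R N\<close> then costs little and yields both constraints at once.\<close>

lemma approx_spectral_factor:
  fixes lam :: "int \<times> int \<Rightarrow> real" and r :: "real \<times> real \<Rightarrow> real"
  assumes lam: "\<And>a b. lam (a + b) = lam a + lam b"
    and u: "(\<lambda>z. of_real (r z)) \<in> trigpolys_on {n. lam n \<le> L}"
    and r: "\<And>z. \<bar>r z\<bar> \<le> \<rho>" and \<rho>: "0 < \<rho>" "\<rho> < 1" and L: "0 \<le> L" and \<epsilon>: "\<epsilon> > 0"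
  obtains P where "P \<in> trigpolys_on {n. 0 \<le> lam n \<and> lam n \<le> L}"
    "\<And>z. \<bar>(cmod (P z))\<^sup>2 - (1 - r z)\<bar> \<le> \<epsilon>"
proof -
  define u where "u z = complex_of_real (r z)" for z
  define H where "H = {n. 0 \<le> lam n}"
  have lam0: "lam 0 = 0" using lam[of 0 0] by simp
  have lam_minus: "lam (- n) = - lam n" for n using lam[of n "- n"] lam0 by simp
  obtain D where D: "D > 0" "u \<in> trigpolys_on ({n. lam n \<le> L} \<inter> freq_box D)"
    using trigpolys_on_freq_box[OF u] unfolding u_def[abs_def] by blast
  have u_pow: "(\<lambda>z. u z ^ k) \<in> trigpolys_on (freq_box (k * D))" for k
    using trigpolys_on_mono[OF D(2), of "freq_box D"]
    by (intro trigpolys_on_power[where T = "\<lambda>k. freq_box (k * D)"] freq_box_add_Suc) auto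
  \<comment> \<open>Sup-norm bound for the analytic half of \<open>u ^ k\<close>. Its summability
    bounds all \<open>g N\<close> by one constant \<open>G\<close>, independent of
    \<open>N\<close>.\<close>
  define q where "q k = (2 * (real k * real D) + 1)\<^sup>2 * \<rho> ^ k" for k
  have q: "summable q" "0 \<le> q k" for k
    unfolding q_def using \<rho> D(1) by (auto intro!: summable_poly_times_power)
  define G where "G = suminf q"
  have G: "0 \<le> G" unfolding G_def using q by (rule suminf_nonneg)

  have "\<exists>Q. Q \<in> trigpolys_on (H \<inter> freq_box (k * D)) \<and> (\<forall>z. Re (Q z) = r z ^ k / 2) \<and>
      (\<forall>z. cmod (Q z) \<le> q k)" for k
  proof -
    have "cmod (u z ^ k) \<le> \<rho> ^ k" for z
      using r by (simp add: u_def norm_power power_mono)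
    from u_pow this lam_minus obtain Q where
      "Q \<in> trigpolys_on ({n. 0 \<le> lam n} \<inter> freq_box (k * D))" "\<And>z. Re (Q z) = Re (u z ^ k) / 2"
      "\<And>z. cmod (Q z) \<le> (2 * real (k * D) + 1)\<^sup>2 * \<rho> ^ k"
      by (rule analytic_half[where v = "\<lambda>z. u z ^ k"]) blast
    moreover have "Re (u z ^ k) = r z ^ k" for z
      unfolding u_def of_real_power[symmetric] by (rule Re_complex_of_real)
    ultimately show ?thesis by (auto simp: H_def q_def intro!: exI[of _ Q])
  qed
  then obtain Q where Q: "Q k \<in> trigpolys_on (H \<inter> freq_box (k * D))" "Re (Q k z) = r z ^ k / 2"
      "cmod (Q k z) \<le> q k" for k z
    by metis

  \<comment> \<open>\<open>2 * Re (g N z)\<close> is the partial sum of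
    \<open>ln (1 - r z) = - (\<Sum>k\<ge>1. r z ^ k / k)\<close>; the summand for
    \<open>k = 0\<close> vanishes because division by 0 gives 0.\<close>
  define g where "g N z = - (\<Sum>k<N. Q k z / of_nat k)" for N z
  define E where "E N w = (\<Sum>k\<le>N. w ^ k / fact k)" for N and w :: complex
  define P where "P N z = E N (g N z)" for N z
  \<comment> \<open>From \<open>1 - u \<approx> exp g * exp (cnj g)\<close> one gets
    \<open>exp g \<approx> (1 - u) * exp (- cnj g)\<close>, where the exponential only has
    frequencies with \<open>lam \<le> 0\<close>.\<close>
  define R where "R N z = (1 - u z) * E N (- cnj (g N z))" for N z

  have g_in: "g N \<in> trigpolys_on (H \<inter> freq_box (N * D))" for N
  proof -
    have "Q k \<in> trigpolys_on (H \<inter> freq_box (N * D))" if "k < N" for k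
      using that freq_box_mono[of "k * D" "N * D"] by (intro trigpolys_on_mono[OF Q(1)]) auto
    then have "(\<lambda>z. \<Sum>k<N. (- 1 / of_nat k) * Q k z) \<in> trigpolys_on (H \<inter> freq_box (N * D))"
      by (intro trigpolys_on_sum trigpolys_on_cmult) auto
    moreover have "g N = (\<lambda>z. \<Sum>k<N. (- 1 / of_nat k) * Q k z)"
      by (auto simp: g_def sum_negf)
    ultimately show ?thesis by simp
  qed
  have P_in: "P N \<in> trigpolys_on (H \<inter> freq_box (N * (N * D)))" for N
  proof -
    have "(\<lambda>z. g N z ^ k) \<in> trigpolys_on (H \<inter> freq_box (k * (N * D)))" for k
      by (rule trigpolys_on_power[OF g_in]) (simp_all add: H_def lam lam0 freq_box_add_Suc del: mult_Suc)
    then have "(\<lambda>z. g N z ^ k) \<in> trigpolys_on (H \<inter> freq_box (N * (N * D)))" if "k \<le> N" for k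
      using that freq_box_mono[of "k * (N * D)" "N * (N * D)"]
      by (intro trigpolys_on_mono[OF \<open>_ \<in> trigpolys_on (H \<inter> freq_box (k * (N * D)))\<close>]) auto
    then have "(\<lambda>z. \<Sum>k\<le>N. (1 / fact k) * g N z ^ k) \<in> trigpolys_on (H \<inter> freq_box (N * (N * D)))"
      by (intro trigpolys_on_sum trigpolys_on_cmult) auto
    then show ?thesis by (simp add: P_def[abs_def] E_def)
  qed
  have R_in: "R N \<in> trigpolys_on {n. lam n \<le> L}" for N
  proof -
    have "(\<lambda>z. cnj (g N z)) \<in> trigpolys_on {n. lam n \<le> 0}"
      using lam_minus by (intro trigpolys_on_cnj[OF g_in]) (auto simp: H_def)
    from trigpolys_on_cmult[OF this, of "- 1"]
    have "(\<lambda>z. - cnj (g N z)) \<in> trigpolys_on {n. lam n \<le> 0}" by simp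
    then have "(\<lambda>z. (- cnj (g N z)) ^ k) \<in> trigpolys_on {n. lam n \<le> 0}" for k
      by (rule trigpolys_on_power) (auto simp: lam lam0)
    then have "(\<lambda>z. \<Sum>k\<le>N. (1 / fact k) * (- cnj (g N z)) ^ k) \<in> trigpolys_on {n. lam n \<le> 0}"
      by (intro trigpolys_on_sum trigpolys_on_cmult)
    then have E_in: "(\<lambda>z. E N (- cnj (g N z))) \<in> trigpolys_on {n. lam n \<le> 0}"
      by (simp add: E_def)
    have "(\<lambda>z. 1 + (- 1) * u z) \<in> trigpolys_on {n. lam n \<le> L}"
      using u L lam0 unfolding u_def by (intro trigpolys_on_add trigpolys_on_cmult trigpolys_on_const) auto
    then have "(\<lambda>z. 1 - u z) \<in> trigpolys_on {n. lam n \<le> L}" by simp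
    from trigpolys_on_mult[OF this E_in, of "{n. lam n \<le> L}"]
    show ?thesis by (auto simp: lam R_def[abs_def])
  qed

  have g_bound: "cmod (g N z) \<le> G" for N z
  proof -
    have "cmod (g N z) \<le> (\<Sum>k<N. q k)"
      unfolding g_def norm_minus_cancel
    proof (rule sum_norm_le)
      fix k
      show "cmod (Q k z / of_nat k) \<le> q k"
      proof (cases "k = 0")
        case False
        then have "cmod (Q k z / of_nat k) \<le> cmod (Q k z) / 1"
          unfolding norm_divide by (intro divide_left_mono) auto
        then show ?thesis using Q(3)[of k z] by simp
      qed (simp add: q)
    qed
    also have "\<dots> \<le> G" unfolding G_def using q by (intro sum_le_suminf) auto
    finally show ?thesis .
  qed
  define C where "C = G * exp (3 * G)"
  define C' where "C' = exp (1 / (1 - \<rho>)) / (1 - \<rho>)"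
  have C: "0 \<le> C" "0 \<le> C'" using G \<rho> by (auto simp: C_def C'_def)
  \<comment> \<open>The tail of the logarithm series, which makes
    \<open>1 - r z = (cmod (exp (g N z)))\<^sup>2 * exp (s N z)\<close> an exact identity.\<close>
  define s where "s N z = ln (1 - r z) - 2 * Re (g N z)" for N z
  have s: "\<bar>exp (s N z) - 1\<bar> \<le> C' * \<rho> ^ N" for N z
  proof -
    have "Re (g N z) = - (\<Sum>k<N. r z ^ k / real k) / 2"
    proof -
      have "Re (Q k z / of_nat k) = r z ^ k / real k / 2" for k
        unfolding Re_divide_of_nat Q(2) by simp
      then have "Re (g N z) = - (\<Sum>k<N. r z ^ k / real k / 2)"
        by (simp only: g_def uminus_complex.sel Re_sum)
      then show ?thesis unfolding sum_divide_distrib[symmetric] by simp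
    qed
    then have "\<bar>s N z\<bar> \<le> \<rho> ^ N / (1 - \<rho>)"
      using ln_series_tail[OF r \<rho>(2), of z N] by (simp add: s_def)
    moreover have "\<rho> ^ N / (1 - \<rho>) \<le> 1 / (1 - \<rho>)"
      using \<rho> by (intro divide_right_mono) (auto simp: power_le_one)
    ultimately have "\<bar>s N z\<bar> * exp \<bar>s N z\<bar> \<le> \<rho> ^ N / (1 - \<rho>) * exp (1 / (1 - \<rho>))"
      by (intro mult_mono) auto
    then show ?thesis
      using abs_exp_minus_one_le[of "s N z"] by (simp add: C'_def mult.commute)
  qed
  have r1: "0 < 1 - r z" "1 - r z \<le> 2" for z using r[of z] \<rho> by auto
  have exp_g: "cmod (exp (g N z)) \<le> exp G" for N z
    using g_bound[of N z] abs_Re_le_cmod[of "g N z"] by (simp add: norm_exp_eq_Re)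
  have r_eq: "1 - r z = (cmod (exp (g N z)))\<^sup>2 * exp (s N z)" for N z
  proof -
    have "(cmod (exp (g N z)))\<^sup>2 * exp (s N z) = exp (2 * Re (g N z) + s N z)"
      by (simp add: norm_exp_eq_Re exp_double exp_add)
    also have "\<dots> = 1 - r z" using r1[of z] by (simp add: s_def)
    finally show ?thesis by simp
  qed

  have P_err: "cmod (P N z - exp (g N z)) \<le> C * (1 / 2) ^ N" for N z
    using exp_truncation_bound[OF g_bound, of N z N]
    by (simp add: P_def E_def C_def norm_minus_commute)
  have R_err: "cmod (R N z - (1 - u z) * exp (- cnj (g N z))) \<le> 2 * (C * (1 / 2) ^ N)" for N z
  proof -
    have "cmod (E N (- cnj (g N z)) - exp (- cnj (g N z))) \<le> C * (1 / 2) ^ N"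
      using exp_truncation_bound[of "- cnj (g N z)" G N] g_bound[of N z]
      by (simp add: E_def C_def norm_minus_commute)
    moreover have "cmod (1 - u z) \<le> 2"
    proof -
      have "1 - u z = of_real (1 - r z)" by (simp add: u_def)
      then show ?thesis using r1[of z] by (simp only: norm_of_real)
    qed
    ultimately have "cmod ((1 - u z) * (E N (- cnj (g N z)) - exp (- cnj (g N z)))) \<le> 2 * (C * (1 / 2) ^ N)"
      unfolding norm_mult by (intro mult_mono) auto
    then show ?thesis by (simp add: R_def algebra_simps)
  qed
  \<comment> \<open>By the exact identity the difference equals \<open>exp g * (1 - exp s)\<close>,
    so only the logarithm tail contributes.\<close>
  have X_err: "cmod (exp (g N z) - (1 - u z) * exp (- cnj (g N z))) \<le> exp G * (C' * \<rho> ^ N)" for N z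
  proof -
    have "complex_of_real ((cmod (exp (g N z)))\<^sup>2) = exp (g N z) * exp (cnj (g N z))"
      using complex_norm_square[of "exp (g N z)"] by (simp add: exp_cnj)
    then have "1 - u z = exp (g N z) * exp (cnj (g N z)) * of_real (exp (s N z))"
      using arg_cong[OF r_eq[of z N], of complex_of_real] by (simp add: u_def)
    then have "exp (g N z) - (1 - u z) * exp (- cnj (g N z)) = exp (g N z) * of_real (1 - exp (s N z))"
      by (simp add: exp_minus field_simps)
    then have "cmod (exp (g N z) - (1 - u z) * exp (- cnj (g N z))) = cmod (exp (g N z)) * \<bar>exp (s N z) - 1\<bar>"
      by (simp only: norm_mult norm_of_real abs_minus_commute)
    also have "\<dots> \<le> exp G * (C' * \<rho> ^ N)"
      using s exp_g by (intro mult_mono) auto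
    finally show ?thesis .
  qed
  \<comment> \<open>The factor 3 collects one truncation error from \<open>P N\<close> and two from
    \<open>R N\<close>, where \<open>1 - u\<close> has modulus at most 2.\<close>
  define e where "e N = 3 * C * (1 / 2) ^ N + exp G * C' * \<rho> ^ N" for N
  have PR: "cmod (P N z - R N z) \<le> e N" for N z
  proof -
    have "P N z - R N z = (P N z - exp (g N z)) + (exp (g N z) - (1 - u z) * exp (- cnj (g N z)))
        - (R N z - (1 - u z) * exp (- cnj (g N z)))" by simp
    then have "cmod (P N z - R N z) \<le> cmod (P N z - exp (g N z))
        + cmod (exp (g N z) - (1 - u z) * exp (- cnj (g N z)))
        + cmod (R N z - (1 - u z) * exp (- cnj (g N z)))"
      by (simp only:) (meson norm_triangle_ineq4 norm_triangle_ineq order_trans add_right_mono)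
    then show ?thesis using P_err[of N z] X_err[of N z] R_err[of N z] by (simp add: e_def mult_ac)
  qed

  \<comment> \<open>\<open>\<kappa> N\<close> bounds the distance from the cut-off
    \<open>P N\<close> to \<open>exp (g N z)\<close>: the cost of the cut-off plus that of
    truncating \<open>exp\<close>. \<open>T N\<close> is the resulting error for the squared
    modulus, including the logarithm tail.\<close>
  define \<kappa> where "\<kappa> N = (2 * (real N * (real N * real D)) + 1)\<^sup>2 * e N + C * (1 / 2) ^ N" for N
  define T where "T N = \<kappa> N * (\<kappa> N + 2 * exp G) + (exp G)\<^sup>2 * (C' * \<rho> ^ N)" for N
  have "\<kappa> \<longlonglongrightarrow> 3 * C * 0 + exp G * C' * 0 + C * 0"
  proof -
    have "(\<lambda>N. 3 * C * ((2 * (real N * (real N * real D)) + 1)\<^sup>2 * (1 / 2) ^ N)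
        + exp G * C' * ((2 * (real N * (real N * real D)) + 1)\<^sup>2 * \<rho> ^ N) + C * (1 / 2) ^ N)
        \<longlonglongrightarrow> 3 * C * 0 + exp G * C' * 0 + C * 0"
      using \<rho> D(1) by (intro tendsto_add tendsto_mult tendsto_const tendsto_poly_times_power LIMSEQ_power_zero) auto
    then show ?thesis by (simp add: \<kappa>_def[abs_def] e_def algebra_simps)
  qed
  then have "T \<longlonglongrightarrow> 0 * (0 + 2 * exp G) + (exp G)\<^sup>2 * (C' * 0)"
    unfolding T_def using \<rho>
    by (intro tendsto_add tendsto_mult tendsto_const LIMSEQ_power_zero) auto
  then have "eventually (\<lambda>N. T N < \<epsilon>) sequentially"
    using \<epsilon> by (intro order_tendstoD) auto
  then obtain N where N: "T N < \<epsilon>" by (auto simp: eventually_sequentially)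

  \<comment> \<open>Comparison with \<open>R N\<close> permits removal of the frequencies of
    \<open>P N\<close> with \<open>lam > L\<close>.\<close>
  obtain P' where P': "P' \<in> trigpolys_on (H \<inter> {n. lam n \<le> L})"
      "\<And>z. cmod (P N z - P' z) \<le> (2 * real (N * (N * D)) + 1)\<^sup>2 * e N"
    using P_in R_in PR by (rule trigpolys_on_truncate) blast
  have "\<bar>(cmod (P' z))\<^sup>2 - (1 - r z)\<bar> \<le> \<epsilon>" for z
  proof -
    have "cmod (P' z - exp (g N z)) \<le> \<kappa> N"
      using P'(2)[of z] P_err[of N z] norm_triangle_ineq[of "P' z - P N z" "P N z - exp (g N z)"]
      by (simp add: \<kappa>_def norm_minus_commute)
    then have "\<bar>(cmod (P' z))\<^sup>2 - (cmod (exp (g N z)))\<^sup>2\<bar> \<le> \<kappa> N * (\<kappa> N + 2 * exp G)"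
      using exp_g by (rule abs_norm_square_diff_le)
    moreover have "\<bar>(cmod (exp (g N z)))\<^sup>2 - (1 - r z)\<bar> \<le> (exp G)\<^sup>2 * (C' * \<rho> ^ N)"
    proof -
      have "(cmod (exp (g N z)))\<^sup>2 - (1 - r z) = (cmod (exp (g N z)))\<^sup>2 * (1 - exp (s N z))"
        unfolding r_eq[of z N] by (simp add: algebra_simps)
      then have "\<bar>(cmod (exp (g N z)))\<^sup>2 - (1 - r z)\<bar> = (cmod (exp (g N z)))\<^sup>2 * \<bar>exp (s N z) - 1\<bar>"
        by (simp only: abs_mult abs_power2 abs_minus_commute)
      also have "\<dots> \<le> (exp G)\<^sup>2 * (C' * \<rho> ^ N)"
        using s exp_g by (intro mult_mono power_mono) auto
      finally show ?thesis .
    qed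
    ultimately show ?thesis using N by (simp add: T_def)
  qed
  moreover have "H \<inter> {n. lam n \<le> L} = {n. 0 \<le> lam n \<and> lam n \<le> L}" by (auto simp: H_def)
  ultimately show ?thesis using P'(1) that by simp
qed

section \<open>Property A\<close>

text \<open>Valid for every \<open>F\<close>: \<open>p * cnj p\<close> has frequencies in the
  difference set, and coefficients, realness and nonnegativity all pass to uniform limits.\<close>

lemma U2_subset_nonneg: "U2 F \<subseteq> nonneg_trigpolys_on (diffset F)"
proof
  fix t assume t: "t \<in> U2 F"
  obtain c A where c: "finite A" "{n. c n \<noteq> 0} \<subseteq> A" "\<And>z. t z = (\<Sum>n\<in>A. c n * chr n z)"
  proof -
    have "t \<in> trigpolys_on UNIV" using t by (simp add: U2_def trigpolys_def)
    then obtain c A where "finite A" "A \<subseteq> UNIV" "{n. c n \<noteq> 0} \<subseteq> A" "\<And>z. t z = (\<Sum>n\<in>A. c n * chr n z)"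
      by (rule trigpolys_onE) blast
    then show ?thesis using that by blast
  qed
  have approx: "\<exists>s. s \<in> trigpolys_on (diffset F) \<and> (\<forall>z. s z \<in> \<real> \<and> 0 \<le> Re (s z)) \<and>
      (\<forall>z. cmod (t z - s z) \<le> \<epsilon>)" if \<epsilon>: "\<epsilon> > 0" for \<epsilon>
  proof -
    obtain p where p: "p \<in> trigpolys_on F" "\<And>z. cmod (t z - of_real ((cmod (p z))\<^sup>2)) \<le> \<epsilon>"
      using t \<epsilon> unfolding U2_def sos_on_def by blast
    have "(\<lambda>z. p z * cnj (p z)) \<in> trigpolys_on (diffset F)"
    proof (rule trigpolys_on_mult[OF p(1) trigpolys_on_cnj[OF p(1), of "uminus ` F"]])
      fix a b assume "a \<in> F" "b \<in> uminus ` F"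
      then show "a + b \<in> diffset F"
        unfolding diffset_def by (force simp: plus_prod_def)
    qed auto
    then have "(\<lambda>z. of_real ((cmod (p z))\<^sup>2)) \<in> trigpolys_on (diffset F)"
      by (simp only: complex_norm_square)
    with p(2) show ?thesis
      by (intro exI[of _ "\<lambda>z. of_real ((cmod (p z))\<^sup>2)"]) auto
  qed
  \<comment> \<open>Approximation within half of \<open>cmod (c m)\<close> would bound a nonzero
    coefficient by half of its own modulus.\<close>
  have "c m = 0" if "m \<in> A" "m \<notin> diffset F" for m
  proof (rule ccontr)
    assume "c m \<noteq> 0"
    then obtain s where "s \<in> trigpolys_on (diffset F)" "\<And>z. cmod (t z - s z) \<le> cmod (c m) / 2"
      using approx[of "cmod (c m) / 2"] by auto
    then have "cmod (c m) \<le> cmod (c m) / 2"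
      using norm_coeff_le_diff[OF c(1,3)] that by blast
    with \<open>c m \<noteq> 0\<close> show False by simp
  qed
  then have "t z = (\<Sum>n\<in>A \<inter> diffset F. c n * chr n z)" for z
    unfolding c(3) using c(1) by (intro sum.mono_neutral_right) auto
  then have "t \<in> trigpolys_on (diffset F)"
    using c(1) by (intro trigpolys_onI[of "A \<inter> diffset F"]) auto
  moreover have "t z \<in> \<real> \<and> 0 \<le> Re (t z)" for z
  proof -
    \<comment> \<open>The shape \<open>0 + \<epsilon>\<close> is the one that
      \<open>field_le_epsilon\<close> matches.\<close>
    have "\<bar>Im (t z)\<bar> \<le> 0 + \<epsilon> \<and> - Re (t z) \<le> 0 + \<epsilon>" if \<epsilon>: "\<epsilon> > 0" for \<epsilon>
    proof -
      obtain s where s: "s z \<in> \<real>" "0 \<le> Re (s z)" "cmod (t z - s z) \<le> \<epsilon>"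
        using approx[OF \<epsilon>] by blast
      then show ?thesis
        using abs_Im_le_cmod[of "t z - s z"] abs_Re_le_cmod[of "t z - s z"]
        by (auto simp: complex_is_Real_iff)
    qed
    then have "\<bar>Im (t z)\<bar> \<le> 0" "- Re (t z) \<le> 0"
      using field_le_epsilon by blast+
    then show ?thesis by (simp add: complex_is_Real_iff)
  qed
  ultimately show "t \<in> nonneg_trigpolys_on (diffset F)"
    by (simp add: nonneg_trigpolys_on_def)
qed

text \<open>Adding a small constant makes \<open>t\<close> strictly positive and rescaling brings it
  to the form \<open>1 - r\<close>; a factor of this is then shifted into the strip
  \<open>F2 \<alpha> \<beta>\<close>.\<close>

lemma nonneg_subset_U2_F2:
  assumes "\<beta> > 0"
  shows "nonneg_trigpolys_on (diffset (F2 \<alpha> \<beta>)) \<subseteq> U2 (F2 \<alpha> \<beta>)"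
proof
  fix t assume t: "t \<in> nonneg_trigpolys_on (diffset (F2 \<alpha> \<beta>))"
  define lam where "lam n = of_int (snd n) - of_int (fst n) * \<alpha>" for n :: "int \<times> int"
  have lam: "lam (a + b) = lam a + lam b" for a b
    by (simp add: lam_def algebra_simps)
  have lam_minus: "lam (- b) = - lam b" for b
    by (simp add: lam_def algebra_simps)
  have F2: "n \<in> F2 \<alpha> \<beta> \<longleftrightarrow> \<bar>lam n\<bar> < \<beta>" for n
    by (cases n) (simp add: F2_def lam_def)
  have "(0, 0) \<in> F2 \<alpha> \<beta>" using assms by (simp add: F2_def)
  then have zero: "0 \<in> diffset (F2 \<alpha> \<beta>)"
    unfolding diffset_def by (force simp: zero_prod_def)
  obtain c A where c: "finite A" "A \<subseteq> diffset (F2 \<alpha> \<beta>)" "\<And>z. t z = (\<Sum>n\<in>A. c n * chr n z)"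
  proof -
    have "t \<in> trigpolys_on (diffset (F2 \<alpha> \<beta>))" using t by (simp add: nonneg_trigpolys_on_def)
    then obtain c A where "finite A" "A \<subseteq> diffset (F2 \<alpha> \<beta>)" "{n. c n \<noteq> 0} \<subseteq> A"
        "\<And>z. t z = (\<Sum>n\<in>A. c n * chr n z)"
      by (rule trigpolys_onE) blast
    then show ?thesis using that by blast
  qed
  define B where "B = (\<Sum>n\<in>A. cmod (c n))"
  have t_re: "t z = of_real (Re (t z))" "0 \<le> Re (t z)" for z
  proof -
    have "t z \<in> \<real> \<and> 0 \<le> Re (t z)" using t unfolding nonneg_trigpolys_on_def by blast
    then show "t z = of_real (Re (t z))" "0 \<le> Re (t z)" by simp_all
  qed
  have B: "Re (t z) \<le> B" "0 \<le> B" for z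
  proof -
    have "cmod (t z) \<le> B"
      unfolding c(3) B_def by (intro sum_norm_le) (simp add: norm_mult)
    then show "Re (t z) \<le> B" using complex_Re_le_cmod order_trans by blast
    show "0 \<le> B" by (simp add: B_def sum_nonneg)
  qed
  \<comment> \<open>Inserting 0 makes the set nonempty and \<open>L\<close> nonnegative. Since the
    maximum is attained at a point of the difference set, \<open>L\<close> is a difference of two
    values strictly inside the strip.\<close>
  define L where "L = Max (lam ` insert 0 A)"
  have "L \<in> lam ` insert 0 A" unfolding L_def using c(1) by (intro Max_in) auto
  then obtain a b where ab: "\<bar>lam a\<bar> < \<beta>" "\<bar>lam b\<bar> < \<beta>" "L = lam a - lam b"
  proof -
    obtain n where n: "n \<in> insert 0 A" "L = lam n" using \<open>L \<in> lam ` insert 0 A\<close> by blast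
    then have "n \<in> diffset (F2 \<alpha> \<beta>)" using zero c(2) by auto
    then obtain a b where "a \<in> F2 \<alpha> \<beta>" "b \<in> F2 \<alpha> \<beta>" "n = a + - b"
      unfolding diffset_def by (auto simp: prod_eq_iff)
    moreover from this have "L = lam a - lam b"
      using n(2) by (simp only: lam lam_minus diff_conv_add_uminus)
    ultimately show ?thesis using that[of a b] by (simp only: F2)
  qed
  have L: "lam n \<le> L" if "n \<in> insert 0 A" for n
    unfolding L_def using c(1) that by (intro Max_ge) auto
  have L0: "0 \<le> L" using L[of 0] by (simp add: lam_def)
  have "\<exists>s\<in>sos_on (F2 \<alpha> \<beta>). \<forall>z. cmod (t z - s z) \<le> \<epsilon>" if \<epsilon>: "\<epsilon> > 0" for \<epsilon>
  proof -
    \<comment> \<open>Half of \<epsilon> pays for the added constant, half for the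
      factorization.\<close>
    define \<delta> where "\<delta> = \<epsilon> / 2"
    \<comment> \<open>The summand \<open>2 * \<delta>\<close> keeps \<open>\<delta> / M < 1\<close>
      even for \<open>B = 0\<close>, so that the bound \<open>1 - \<delta> / M\<close> on
      \<open>r\<close> lies strictly between 0 and 1.\<close>
    define M where "M = B + 2 * \<delta>"
    define r where "r z = 1 - (Re (t z) + \<delta>) / M" for z
    have \<delta>: "\<delta> > 0" using \<epsilon> by (simp add: \<delta>_def)
    have M: "M > 0" "\<delta> / M < 1" using \<delta> B(2) by (auto simp: M_def)
    have r: "\<bar>r z\<bar> \<le> 1 - \<delta> / M" for z
    proof -
      have "\<delta> / M \<le> (Re (t z) + \<delta>) / M" "(Re (t z) + \<delta>) / M \<le> 1"
        using t_re(2)[of z] B(1)[of z] M(1) \<delta> by (auto simp: M_def field_simps)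
      then show ?thesis by (simp add: r_def)
    qed
    have "(\<lambda>z. complex_of_real (r z)) \<in> trigpolys_on {n. lam n \<le> L}"
    proof -
      have "t \<in> trigpolys_on {n. lam n \<le> L}"
        using c L by (intro trigpolys_onI[of A _ _ c]) auto
      moreover have "0 \<in> {n. lam n \<le> L}" using L by simp
      ultimately have "(\<lambda>z. of_real (1 - \<delta> / M) + of_real (- 1 / M) * t z) \<in> trigpolys_on {n. lam n \<le> L}"
        by (intro trigpolys_on_add trigpolys_on_cmult trigpolys_on_const)
      moreover have "of_real (1 - \<delta> / M) + of_real (- 1 / M) * t z = complex_of_real (r z)" for z
        by (subst t_re(1)) (simp add: r_def add_divide_distrib flip: of_real_mult of_real_add of_real_diff of_real_divide)
      ultimately show ?thesis by simp
    qed
    from approx_spectral_factor[OF lam this r _ _ L0, of "\<delta> / M"] M \<delta>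
    obtain P where P: "P \<in> trigpolys_on {n. 0 \<le> lam n \<and> lam n \<le> L}"
        "\<And>z. \<bar>(cmod (P z))\<^sup>2 - (1 - r z)\<bar> \<le> \<delta> / M"
      by (auto simp: field_simps)
    \<comment> \<open>\<open>sqrt M\<close> undoes the scaling. The character moves
      \<open>lam\<close> from \<open>[0, L]\<close> to \<open>[- lam a, - lam b]\<close>, an
      interval inside \<open>(- \<beta>, \<beta>)\<close>, without changing the modulus.\<close>
    define p where "p z = of_real (sqrt M) * chr (- a) z * P z" for z
    have "p \<in> trigpolys_on (F2 \<alpha> \<beta>)"
      unfolding p_def
    proof (rule trigpolys_on_mult[OF trigpolys_on_monom P(1)])
      show "- a \<in> {- a}" by simp
      fix m n assume "m \<in> {- a}" "n \<in> {n. 0 \<le> lam n \<and> lam n \<le> L}"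
      then have "lam (m + n) = lam n - lam a" "0 \<le> lam n" "lam n \<le> L"
        unfolding lam by (auto simp: lam_minus)
      then show "m + n \<in> F2 \<alpha> \<beta>"
        using ab unfolding F2 by linarith
    qed
    moreover have "cmod (t z - of_real ((cmod (p z))\<^sup>2)) \<le> \<epsilon>" for z
    proof -
      have "(cmod (p z))\<^sup>2 = M * (cmod (P z))\<^sup>2"
        using M(1) by (simp add: p_def norm_mult power_mult_distrib)
      moreover have "Re (t z) = M * (1 - r z) - \<delta>" using M(1) by (simp add: r_def)
      ultimately have "Re (t z) - (cmod (p z))\<^sup>2 = - (M * ((cmod (P z))\<^sup>2 - (1 - r z))) - \<delta>"
        by (simp add: algebra_simps)
      moreover have "\<bar>M * ((cmod (P z))\<^sup>2 - (1 - r z))\<bar> \<le> \<delta>"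
        using mult_left_mono[OF P(2)[of z], of M] M(1) by (simp add: abs_mult)
      ultimately have "\<bar>Re (t z) - (cmod (p z))\<^sup>2\<bar> \<le> \<epsilon>"
        unfolding \<delta>_def by linarith
      then show ?thesis
        by (subst t_re(1)) (simp only: of_real_diff[symmetric] norm_of_real)
    qed
    ultimately show ?thesis
      unfolding sos_on_def by (intro bexI[of _ "\<lambda>z. of_real ((cmod (p z))\<^sup>2)"]) auto
  qed
  moreover have "t \<in> trigpolys"
    using t trigpolys_on_mono unfolding trigpolys_def nonneg_trigpolys_on_def by blast
  ultimately show "t \<in> U2 (F2 \<alpha> \<beta>)" by (simp add: U2_def)
qed

theorem theorem4:
  fixes \<alpha> \<beta> :: real
  assumes "\<alpha> \<in> \<rat> \<or> (\<alpha> \<notin> \<rat> \<and> liouville_roth \<alpha> > 2)"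
    and "\<beta> > 0"
  shows "property_A (F2 \<alpha> \<beta>)"
  unfolding property_A_def
  using U2_subset_nonneg nonneg_subset_U2_F2[OF assms(2)] by (rule subset_antisym)

end
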